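(* Let $\mathcal{A}$ be a directed set and let $\{(\mathcal{I}_\alpha,\mathsf{B}_\alpha)\}_{\alpha\in\mathcal{A}}$ be a family such that each $\mathcal{I}_\alpha$ is a set and $\mathsf{B}_\alpha$ is a pointed building set on $\mathcal{I}_\alpha$; for all $\alpha\le\beta$ in $\mathcal{A}$ we have $\mathcal{I}_\alpha\subseteq\mathcal{I}_\beta$ and $\mathsf{B}_\alpha\subseteq\mathsf{B}_\beta$; and each $\mathsf{B}_\alpha$ is locally finite. Then, in the category of posets, $\varprojlim \mathcal{O}(\mathsf{B}_\alpha)\simeq\mathcal{O}\left(\varinjlim\mathsf{B}_\alpha\right)$, where the inverse limit is taken over the inverse system $(\mathcal{O}(\mathsf{B}_\alpha))_{\alpha\in\mathcal{A}}$ with transition maps $\Psi_{\beta\alpha}$.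
   Context: Let $\mathcal{I}$ be a set. A pointed subset $(S,i)$ of $\mathcal{I}$ is a pair with $S\subseteq\mathcal{I}$, $i\in S$ (pointed at $i$); it is often identified with its underlying set $S$. For a collection $\mathcal{C}$ of pointed subsets, $\mathcal{C}|_i:=\{(S,j)\in\mathcal{C}\mid j=i\}$. A pointed building set $\mathsf{B}$ on $\mathcal{I}$ is a collection of pointed subsets of $\mathcal{I}$ such that: (1) $(\{i\},i)\in\mathsf{B}$ for all $i$; (2) if $(S,i),(T,j)\in\mathsf{B}$ and $j\in S$ then $(S\cup T,i)\in\mathsf{B}$; (3) each $\mathsf{B}|_i$ is closed under arbitrary non-empty unions. An ornamentation of $\mathsf{B}$ is a function $\rho:\mathcal{I}\to\mathsf{B}$ with $\rho(i)\in\mathsf{B}|_i$ for all $i$, and $\rho(j)\subseteq\rho(i)$ whenever $j\in\rho(i)$. $\mathcal{O}(\mathsf{B})$ is the set of ornamentations ordered by $\rho_1\preceq\rho_2$ iff $\rho_1(i)\subseteq\rho_2(i)$ for all $i$. $\mathsf{B}_\alpha$ is locally finite if for all $i\in\mathcal{I}_\alpha$, every set in $\mathsf{B}_\alpha|_i$ is finite. Define $\varinjlim\mathcal{I}_\alpha:=\bigcup_{\alpha\in\mathcal{A}}\mathcal{I}_\alpha$. For a collection $\mathcal{C}$ of pointed subsets of a set $\mathcal{I}$, the pointwise union closure is $\mathrm{PUC}(\mathcal{C}):=\{(\bigcup_{(S,i)\in\mathsf{A}}S,\ i)\mid i\in\mathcal{I},\ \emptyset\subsetneq\mathsf{A}\subseteq\mathcal{C}|_i\}$.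 Define $\varinjlim\mathsf{B}_\alpha:=\mathrm{PUC}\left(\bigcup_{\alpha\in\mathcal{A}}\mathsf{B}_\alpha\right)$, which is a pointed building set on $\varinjlim\mathcal{I}_\alpha$. For $\alpha\le\beta$ in $\mathcal{A}$, the order-preserving map $\Psi_{\beta\alpha}:\mathcal{O}(\mathsf{B}_\beta)\to\mathcal{O}(\mathsf{B}_\alpha)$ is defined, for $i\in\mathcal{I}_\alpha$, by letting $\Psi_{\beta\alpha}(\rho)(i)$ be the largest (under inclusion) element of $\mathsf{B}_\alpha|_i$ contained in $\rho(i)$; these satisfy $\Psi_{\beta\alpha}\circ\Psi_{\gamma\beta}=\Psi_{\gamma\alpha}$ for $\alpha\le\beta\le\gamma$. *)

theory Defs
  imports "HOL-Algebra.Order" "HOL-Library.FuncSet"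
begin

section \<open>Pointed building sets\<close>

text \<open>A pointed subset \<open>(S, i)\<close> is a pair, so that \<open>fst\<close> is the underlying set and
  \<open>snd\<close> the point.\<close>

definition pointed_subset :: "'a set \<Rightarrow> 'a set \<times> 'a \<Rightarrow> bool" where
  "pointed_subset I P \<longleftrightarrow> fst P \<subseteq> I \<and> snd P \<in> fst P"

definition pointed_at :: "('a set \<times> 'a) set \<Rightarrow> 'a \<Rightarrow> ('a set \<times> 'a) set" where
  "pointed_at C i = {P \<in> C. snd P = i}"

definition pointed_building_set :: "'a set \<Rightarrow> ('a set \<times> 'a) set \<Rightarrow> bool" where
  "pointed_building_set I B \<longleftrightarrow>
     (\<forall>P\<in>B. pointed_subset I P) \<and>
     (\<forall>i\<in>I. ({i}, i) \<in> B) \<and>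
     (\<forall>S i T j. (S, i) \<in> B \<longrightarrow> (T, j) \<in> B \<longrightarrow> j \<in> S \<longrightarrow> (S \<union> T, i) \<in> B) \<and>
     (\<forall>i\<in>I. \<forall>C. C \<noteq> {} \<longrightarrow> C \<subseteq> pointed_at B i \<longrightarrow> (\<Union>P\<in>C. fst P, i) \<in> B)"

definition locally_finite :: "'a set \<Rightarrow> ('a set \<times> 'a) set \<Rightarrow> bool" where
  "locally_finite I B \<longleftrightarrow> (\<forall>i\<in>I. \<forall>P\<in>pointed_at B i. finite (fst P))"

definition PUC :: "'a set \<Rightarrow> ('a set \<times> 'a) set \<Rightarrow> ('a set \<times> 'a) set" where
  "PUC I C = {(\<Union>P\<in>D. fst P, i) | i D. i \<in> I \<and> D \<noteq> {} \<and> D \<subseteq> pointed_at C i}"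


section \<open>Posets\<close>

text \<open>Posets are the structures of \<open>HOL-Algebra.Order\<close>, with the equality slot always being
  the equality of HOL.\<close>

definition poset_of :: "'x set \<Rightarrow> ('x \<Rightarrow> 'x \<Rightarrow> bool) \<Rightarrow> 'x gorder" where
  "poset_of X r = \<lparr>carrier = X, eq = (=), le = r\<rparr>"

definition poset_hom :: "'x gorder \<Rightarrow> 'y gorder \<Rightarrow> ('x \<Rightarrow> 'y) set" where
  "poset_hom L M = {f \<in> carrier L \<rightarrow>\<^sub>E carrier M. isotone L M f}"

definition poset_isomorphic :: "'x gorder \<Rightarrow> 'y gorder \<Rightarrow> bool" where
  "poset_isomorphic L M \<longleftrightarrow> partial_order L \<and> partial_order M \<and>
     (\<exists>f\<in>poset_hom L M. \<exists>g\<in>poset_hom M L.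
        (\<forall>x\<in>carrier L. g (f x) = x) \<and> (\<forall>y\<in>carrier M. f (g y) = y))"

definition directed_set :: "'k set \<Rightarrow> ('k \<Rightarrow> 'k \<Rightarrow> bool) \<Rightarrow> bool" where
  "directed_set A leA \<longleftrightarrow> A \<noteq> {} \<and> reflp_on A leA \<and> transp_on A leA \<and>
     (\<forall>\<alpha>\<in>A. \<forall>\<beta>\<in>A. \<exists>\<gamma>\<in>A. leA \<alpha> \<gamma> \<and> leA \<beta> \<gamma>)"

text \<open>The transition map \<open>\<phi> \<beta> \<alpha>\<close> goes from \<open>P \<beta>\<close> to \<open>P \<alpha>\<close>, for \<open>\<alpha> \<le> \<beta>\<close>.  The inverse limit is
  the subposet of compatible families in the product; its universal property in the category of
  posets is lemma \<open>inverse_limit_universal\<close> below.\<close>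

definition inverse_limit ::
  "'k set \<Rightarrow> ('k \<Rightarrow> 'k \<Rightarrow> bool) \<Rightarrow> ('k \<Rightarrow> 'x gorder) \<Rightarrow> ('k \<Rightarrow> 'k \<Rightarrow> 'x \<Rightarrow> 'x) \<Rightarrow> ('k \<Rightarrow> 'x) gorder"
  where
  "inverse_limit A leA P \<phi> = poset_of
     {x \<in> \<Pi>\<^sub>E \<alpha>\<in>A. carrier (P \<alpha>). \<forall>\<alpha>\<in>A. \<forall>\<beta>\<in>A. leA \<alpha> \<beta> \<longrightarrow> \<phi> \<beta> \<alpha> (x \<beta>) = x \<alpha>}
     (\<lambda>x y. \<forall>\<alpha>\<in>A. gorder.le (P \<alpha>) (x \<alpha>) (y \<alpha>))"


section \<open>Ornamentations\<close>

definition ornamentations :: "'a set \<Rightarrow> ('a set \<times> 'a) set \<Rightarrow> ('a \<Rightarrow> 'a set \<times> 'a) set" where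
  "ornamentations I B = {\<rho> \<in> \<Pi>\<^sub>E i\<in>I. pointed_at B i.
     \<forall>i\<in>I. \<forall>j\<in>fst (\<rho> i). fst (\<rho> j) \<subseteq> fst (\<rho> i)}"

definition ornamentation_poset ::
  "'a set \<Rightarrow> ('a set \<times> 'a) set \<Rightarrow> ('a \<Rightarrow> 'a set \<times> 'a) gorder" where
  "ornamentation_poset I B = poset_of (ornamentations I B)
     (\<lambda>\<rho>\<^sub>1 \<rho>\<^sub>2. \<forall>i\<in>I. fst (\<rho>\<^sub>1 i) \<subseteq> fst (\<rho>\<^sub>2 i))"

definition largest_inside :: "('a set \<times> 'a) set \<Rightarrow> 'a \<Rightarrow> 'a set \<Rightarrow> 'a set \<times> 'a" where
  "largest_inside B i S = (THE P.
     greatest (poset_of (pointed_at B i) (\<lambda>Q R. fst Q \<subseteq> fst R)) P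
       {Q \<in> pointed_at B i. fst Q \<subseteq> S})"

definition Psi :: "('k \<Rightarrow> 'a set) \<Rightarrow> ('k \<Rightarrow> ('a set \<times> 'a) set) \<Rightarrow>
    'k \<Rightarrow> 'k \<Rightarrow> ('a \<Rightarrow> 'a set \<times> 'a) \<Rightarrow> ('a \<Rightarrow> 'a set \<times> 'a)" where
  "Psi I B \<beta> \<alpha> =
     (\<lambda>\<rho>\<in>ornamentations (I \<beta>) (B \<beta>). \<lambda>i\<in>I \<alpha>. largest_inside (B \<alpha>) i (fst (\<rho> i)))"


section \<open>Direct limits of pointed building sets\<close>

definition direct_limit_set :: "'k set \<Rightarrow> ('k \<Rightarrow> 'a set) \<Rightarrow> 'a set" where
  "direct_limit_set A I = (\<Union>\<alpha>\<in>A. I \<alpha>)"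

definition direct_limit_pbs ::
  "'k set \<Rightarrow> ('k \<Rightarrow> 'a set) \<Rightarrow> ('k \<Rightarrow> ('a set \<times> 'a) set) \<Rightarrow> ('a set \<times> 'a) set" where
  "direct_limit_pbs A I B = PUC (direct_limit_set A I) (\<Union>\<alpha>\<in>A. B \<alpha>)"


section \<open>Well-definedness\<close>

lemma poset_of_simps [simp]:
  "carrier (poset_of X r) = X" "eq (poset_of X r) = (=)" "gorder.le (poset_of X r) = r"
  by (simp_all add: poset_of_def)

lemma partial_order_poset_of:
  assumes "\<And>x. x \<in> X \<Longrightarrow> r x x"
    and "\<And>x y. \<lbrakk>x \<in> X; y \<in> X; r x y; r y x\<rbrakk> \<Longrightarrow> x = y"
    and "\<And>x y z. \<lbrakk>x \<in> X; y \<in> X; z \<in> X; r x y; r y z\<rbrakk> \<Longrightarrow> r x z"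
  shows "partial_order (poset_of X r)"
  by unfold_locales (simp_all add: poset_of_def, (blast intro: assms)+)

lemma partial_order_ornamentation_poset: "partial_order (ornamentation_poset I B)"
  unfolding ornamentation_poset_def
proof (rule partial_order_poset_of)
  fix \<rho> \<sigma> assume *: "\<rho> \<in> ornamentations I B" "\<sigma> \<in> ornamentations I B"
    "\<forall>i\<in>I. fst (\<rho> i) \<subseteq> fst (\<sigma> i)" "\<forall>i\<in>I. fst (\<sigma> i) \<subseteq> fst (\<rho> i)"
  have "\<rho> i = \<sigma> i" if "i \<in> I" for i
  proof (rule prod_eqI)
    show "fst (\<rho> i) = fst (\<sigma> i)" using * that by blast
    have "\<rho> i \<in> pointed_at B i" "\<sigma> i \<in> pointed_at B i"
      using * that by (auto simp: ornamentations_def)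
    then show "snd (\<rho> i) = snd (\<sigma> i)" by (simp add: pointed_at_def)
  qed
  moreover have "\<rho> \<in> extensional I" "\<sigma> \<in> extensional I"
    using * by (auto simp: ornamentations_def PiE_def)
  ultimately show "\<rho> = \<sigma>" by (rule extensionalityI[rotated 2])
qed auto

lemma partial_order_inverse_limit:
  assumes P: "\<And>\<alpha>. \<alpha> \<in> A \<Longrightarrow> partial_order (P \<alpha>)"
  shows "partial_order (inverse_limit A leA P \<phi>)"
  unfolding inverse_limit_def
proof (rule partial_order_poset_of, goal_cases)
  case (1 x)
  then show ?case
    by (auto intro!: weak_partial_order.le_refl partial_order.axioms(1)[OF P])
next
  case (2 x y)
  have "x \<alpha> = y \<alpha>" if "\<alpha> \<in> A" for \<alpha>
    using 2 that by (auto intro!: partial_order.le_antisym[OF P])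
  then show ?case using 2 by (auto intro: PiE_ext)
next
  case (3 x y z)
  show ?case
  proof
    fix \<alpha> assume "\<alpha> \<in> A"
    then interpret weak_partial_order "P \<alpha>" by (rule partial_order.axioms(1)[OF P])
    have "x \<alpha> \<in> carrier (P \<alpha>)" "y \<alpha> \<in> carrier (P \<alpha>)" "z \<alpha> \<in> carrier (P \<alpha>)"
      "gorder.le (P \<alpha>) (x \<alpha>) (y \<alpha>)" "gorder.le (P \<alpha>) (y \<alpha>) (z \<alpha>)"
      using 3 \<open>\<alpha> \<in> A\<close> by blast+
    then show "gorder.le (P \<alpha>) (x \<alpha>) (z \<alpha>)" using le_trans by blast
  qed
qed

lemma inverse_limit_universal:
  assumes P: "\<And>\<alpha>. \<alpha> \<in> A \<Longrightarrow> partial_order (P \<alpha>)"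
    and T: "partial_order T"
    and f: "\<And>\<alpha>. \<alpha> \<in> A \<Longrightarrow> f \<alpha> \<in> poset_hom T (P \<alpha>)"
    and compat: "\<And>\<alpha> \<beta> t. \<lbrakk>\<alpha> \<in> A; \<beta> \<in> A; leA \<alpha> \<beta>; t \<in> carrier T\<rbrakk> \<Longrightarrow> \<phi> \<beta> \<alpha> (f \<beta> t) = f \<alpha> t"
  shows "\<exists>!h. h \<in> poset_hom T (inverse_limit A leA P \<phi>) \<and>
           (\<forall>\<alpha>\<in>A. \<forall>t\<in>carrier T. h t \<alpha> = f \<alpha> t)"
proof (rule ex1I)
  let ?h = "\<lambda>t\<in>carrier T. \<lambda>\<alpha>\<in>A. f \<alpha> t"
  have "?h t \<in> carrier (inverse_limit A leA P \<phi>)" if "t \<in> carrier T" for t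
    using that f compat by (auto simp: inverse_limit_def poset_hom_def PiE_iff)
  moreover have "isotone T (inverse_limit A leA P \<phi>) ?h"
    using partial_order.axioms(1)[OF T] f
      partial_order.axioms(1)[OF partial_order_inverse_limit[OF P]]
    by (auto simp: isotone_def inverse_limit_def poset_hom_def)
  ultimately show "?h \<in> poset_hom T (inverse_limit A leA P \<phi>) \<and>
      (\<forall>\<alpha>\<in>A. \<forall>t\<in>carrier T. ?h t \<alpha> = f \<alpha> t)"
    by (auto simp: poset_hom_def)
next
  fix h assume h: "h \<in> poset_hom T (inverse_limit A leA P \<phi>) \<and>
      (\<forall>\<alpha>\<in>A. \<forall>t\<in>carrier T. h t \<alpha> = f \<alpha> t)"
  show "h = (\<lambda>t\<in>carrier T. \<lambda>\<alpha>\<in>A. f \<alpha> t)"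
  proof (rule ext)
    fix t
    show "h t = (\<lambda>t\<in>carrier T. \<lambda>\<alpha>\<in>A. f \<alpha> t) t"
    proof (cases "t \<in> carrier T")
      case True
      then have "h t \<in> (\<Pi>\<^sub>E \<alpha>\<in>A. carrier (P \<alpha>))"
        using h by (auto simp: poset_hom_def inverse_limit_def)
      then show ?thesis using True h by (auto simp: fun_eq_iff PiE_iff extensional_def)
    next
      case False
      then show ?thesis using h by (auto simp: poset_hom_def PiE_iff extensional_def)
    qed
  qed
qed

lemma projection_poset_hom:
  assumes P: "\<And>\<alpha>. \<alpha> \<in> A \<Longrightarrow> partial_order (P \<alpha>)" and "\<alpha> \<in> A"
  shows "(\<lambda>x\<in>carrier (inverse_limit A leA P \<phi>). x \<alpha>) \<in> poset_hom (inverse_limit A leA P \<phi>) (P \<alpha>)"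
  using partial_order.axioms(1)[OF partial_order_inverse_limit[OF P]]
    partial_order.axioms(1)[OF P] \<open>\<alpha> \<in> A\<close>
  by (auto simp: poset_hom_def isotone_def inverse_limit_def)

lemma pointed_at_pair: "P \<in> pointed_at C i \<Longrightarrow> (fst P, i) \<in> C"
  by (cases P) (simp add: pointed_at_def)

lemma pointed_building_setD:
  assumes "pointed_building_set I B"
  shows "\<And>P i. P \<in> pointed_at B i \<Longrightarrow> i \<in> fst P \<and> fst P \<subseteq> I"
    and "\<And>i. i \<in> I \<Longrightarrow> ({i}, i) \<in> pointed_at B i"
    and "\<And>S i T j. \<lbrakk>(S, i) \<in> B; (T, j) \<in> B; j \<in> S\<rbrakk> \<Longrightarrow> (S \<union> T, i) \<in> B"
    and "\<And>i C. \<lbrakk>i \<in> I; C \<noteq> {}; C \<subseteq> pointed_at B i\<rbrakk> \<Longrightarrow> (\<Union>P\<in>C. fst P, i) \<in> B"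
proof -
  note B = assms[unfolded pointed_building_set_def pointed_subset_def]
  show "i \<in> fst P \<and> fst P \<subseteq> I" if "P \<in> pointed_at B i" for P i
    using B that unfolding pointed_at_def by blast
  show "({i}, i) \<in> pointed_at B i" if "i \<in> I" for i
    using B that unfolding pointed_at_def by simp
  show "(S \<union> T, i) \<in> B" if "(S, i) \<in> B" "(T, j) \<in> B" "j \<in> S" for S i T j
    using B that by blast
  show "(\<Union>P\<in>C. fst P, i) \<in> B" if "i \<in> I" "C \<noteq> {}" "C \<subseteq> pointed_at B i" for i C
    using B that by blast
qed

lemma largest_inside:
  assumes B: "pointed_building_set I B" and i: "i \<in> I" "i \<in> S"
  shows "largest_inside B i S \<in> pointed_at B i"
    and "fst (largest_inside B i S) \<subseteq> S"
    and "\<And>Q. \<lbrakk>Q \<in> pointed_at B i; fst Q \<subseteq> S\<rbrakk> \<Longrightarrow> fst Q \<subseteq> fst (largest_inside B i S)"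
proof -
  let ?C = "{Q \<in> pointed_at B i. fst Q \<subseteq> S}"
  let ?g = "\<lambda>P. greatest (poset_of (pointed_at B i) (\<lambda>Q R. fst Q \<subseteq> fst R)) P ?C"
  have "({i}, i) \<in> ?C" using pointed_building_setD(2)[OF B i(1)] i by simp
  then have "?C \<noteq> {}" by blast
  then have u: "(\<Union>P\<in>?C. fst P, i) \<in> B"
    by (intro pointed_building_setD(4)[OF B i(1)]) blast+
  then have "?g (\<Union>P\<in>?C. fst P, i)"
    by (auto simp: greatest_def pointed_at_def)
  moreover have g: "P \<in> ?C" "\<forall>Q\<in>?C. fst Q \<subseteq> fst P" if "?g P" for P
    using that unfolding greatest_def poset_of_simps by blast+
  have "P = Q" if "?g P" "?g Q" for P Q
  proof (rule prod_eqI)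
    show "fst P = fst Q" using g[OF that(1)] g[OF that(2)] by blast
    show "snd P = snd Q" using g(1)[OF that(1)] g(1)[OF that(2)] by (simp add: pointed_at_def)
  qed
  ultimately have *: "?g (largest_inside B i S)"
    unfolding largest_inside_def by (intro theI'[of ?g] ex1I) assumption+
  from g[OF *] show "largest_inside B i S \<in> pointed_at B i" "fst (largest_inside B i S) \<subseteq> S"
    "\<And>Q. \<lbrakk>Q \<in> pointed_at B i; fst Q \<subseteq> S\<rbrakk> \<Longrightarrow> fst Q \<subseteq> fst (largest_inside B i S)"
    by blast+
qed

lemma ornamentationsD:
  assumes "pointed_building_set I B" "\<rho> \<in> ornamentations I B" "i \<in> I"
  shows "\<rho> i \<in> pointed_at B i" "i \<in> fst (\<rho> i)" "fst (\<rho> i) \<subseteq> I"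
    "\<And>j. j \<in> fst (\<rho> i) \<Longrightarrow> fst (\<rho> j) \<subseteq> fst (\<rho> i)"
proof -
  show *: "\<rho> i \<in> pointed_at B i"
    using assms(2,3) by (auto simp: ornamentations_def)
  show "i \<in> fst (\<rho> i)" "fst (\<rho> i) \<subseteq> I"
    using pointed_building_setD(1)[OF assms(1) *] by auto
  show "fst (\<rho> j) \<subseteq> fst (\<rho> i)" if "j \<in> fst (\<rho> i)" for j
    using assms(2,3) that by (auto simp: ornamentations_def)
qed

lemma Psi_ornamentations:
  assumes Ba: "pointed_building_set (I \<alpha>) (B \<alpha>)" and Bb: "pointed_building_set (I \<beta>) (B \<beta>)"
    and sub: "I \<alpha> \<subseteq> I \<beta>" and \<rho>: "\<rho> \<in> ornamentations (I \<beta>) (B \<beta>)"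
  shows "Psi I B \<beta> \<alpha> \<rho> \<in> ornamentations (I \<alpha>) (B \<alpha>)"
proof -
  define l where "l i = largest_inside (B \<alpha>) i (fst (\<rho> i))" for i
  have l: "l i \<in> pointed_at (B \<alpha>) i" "fst (l i) \<subseteq> fst (\<rho> i)"
    "\<And>Q. \<lbrakk>Q \<in> pointed_at (B \<alpha>) i; fst Q \<subseteq> fst (\<rho> i)\<rbrakk> \<Longrightarrow> fst Q \<subseteq> fst (l i)" if "i \<in> I \<alpha>" for i
  proof -
    have "i \<in> fst (\<rho> i)" using ornamentationsD(2)[OF Bb \<rho>] that sub by blast
    note largest_inside[OF Ba \<open>i \<in> I \<alpha>\<close> this, folded l_def]
    then show "l i \<in> pointed_at (B \<alpha>) i" "fst (l i) \<subseteq> fst (\<rho> i)"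
      "\<And>Q. \<lbrakk>Q \<in> pointed_at (B \<alpha>) i; fst Q \<subseteq> fst (\<rho> i)\<rbrakk> \<Longrightarrow> fst Q \<subseteq> fst (l i)"
      by simp_all
  qed
  have "j \<in> I \<alpha> \<and> fst (l j) \<subseteq> fst (l i)" if i: "i \<in> I \<alpha>" and j: "j \<in> fst (l i)" for i j
  proof -
    have jI: "j \<in> I \<alpha>"
      using pointed_building_setD(1)[OF Ba l(1)[OF i]] j by blast
    have "(fst (l i), i) \<in> B \<alpha>" "(fst (l j), j) \<in> B \<alpha>"
      using l(1)[OF i] l(1)[OF jI] by (simp_all add: pointed_at_pair)
    then have "(fst (l i) \<union> fst (l j), i) \<in> B \<alpha>"
      using pointed_building_setD(3)[OF Ba] j by blast
    moreover have "fst (l j) \<subseteq> fst (\<rho> i)"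
      using l(2)[OF jI] l(2)[OF i] j ornamentationsD(4)[OF Bb \<rho>, of i j] i sub by blast
    ultimately show ?thesis
      using l(3)[OF i, of "(fst (l i) \<union> fst (l j), i)"] l(2)[OF i] jI
      by (auto simp: pointed_at_def)
  qed
  moreover have "Psi I B \<beta> \<alpha> \<rho> = restrict l (I \<alpha>)"
    using \<rho> unfolding Psi_def by (simp add: l_def restrict_def fun_eq_iff)
  ultimately show ?thesis
    using l(1) unfolding ornamentations_def by auto
qed

lemma Psi_poset_hom:
  assumes Ba: "pointed_building_set (I \<alpha>) (B \<alpha>)" and Bb: "pointed_building_set (I \<beta>) (B \<beta>)"
    and sub: "I \<alpha> \<subseteq> I \<beta>"
  shows "Psi I B \<beta> \<alpha> \<in> poset_hom (ornamentation_poset (I \<beta>) (B \<beta>)) (ornamentation_poset (I \<alpha>) (B \<alpha>))"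
proof -
  have "fst (Psi I B \<beta> \<alpha> \<rho> i) \<subseteq> fst (Psi I B \<beta> \<alpha> \<sigma> i)"
    if "\<rho> \<in> ornamentations (I \<beta>) (B \<beta>)" "\<sigma> \<in> ornamentations (I \<beta>) (B \<beta>)"
      "\<forall>i\<in>I \<beta>. fst (\<rho> i) \<subseteq> fst (\<sigma> i)" "i \<in> I \<alpha>" for \<rho> \<sigma> i
  proof -
    have i: "i \<in> I \<beta>" using that sub by blast
    note r = largest_inside[OF Ba that(4) ornamentationsD(2)[OF Bb that(1) i]]
      and s = largest_inside[OF Ba that(4) ornamentationsD(2)[OF Bb that(2) i]]
    show ?thesis using that r(2) i s(3)[OF r(1)] by (auto simp: Psi_def)
  qed
  then show ?thesis
    using Psi_ornamentations[OF Ba Bb sub] partial_order.axioms(1)[OF partial_order_ornamentation_poset]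
    unfolding poset_hom_def isotone_def
    by (auto simp: ornamentation_poset_def) (auto simp: Psi_def)
qed

lemma Psi_comp:
  assumes Ba: "pointed_building_set (I \<alpha>) (B \<alpha>)" and Bb: "pointed_building_set (I \<beta>) (B \<beta>)"
    and Bc: "pointed_building_set (I \<gamma>) (B \<gamma>)"
    and sub: "I \<alpha> \<subseteq> I \<beta>" "I \<beta> \<subseteq> I \<gamma>" "B \<alpha> \<subseteq> B \<beta>"
    and \<rho>: "\<rho> \<in> ornamentations (I \<gamma>) (B \<gamma>)"
  shows "Psi I B \<beta> \<alpha> (Psi I B \<gamma> \<beta> \<rho>) = Psi I B \<gamma> \<alpha> \<rho>"
proof -
  have \<sigma>: "Psi I B \<gamma> \<beta> \<rho> \<in> ornamentations (I \<beta>) (B \<beta>)"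
    using Psi_ornamentations[OF Bb Bc sub(2) \<rho>] .
  have "largest_inside (B \<alpha>) i (fst (Psi I B \<gamma> \<beta> \<rho> i)) = largest_inside (B \<alpha>) i (fst (\<rho> i))"
    (is "?l = ?m") if i: "i \<in> I \<alpha>" for i
  proof (rule prod_eqI)
    have ib: "i \<in> I \<beta>" and ic: "i \<in> I \<gamma>" using i sub by auto
    note m = largest_inside[OF Ba i ornamentationsD(2)[OF Bc \<rho> ic]]
      and n = largest_inside[OF Bb ib ornamentationsD(2)[OF Bc \<rho> ic]]
      and l = largest_inside[OF Ba i ornamentationsD(2)[OF Bb \<sigma> ib]]
    have s: "Psi I B \<gamma> \<beta> \<rho> i = largest_inside (B \<beta>) i (fst (\<rho> i))"
      using \<rho> ib by (simp add: Psi_def)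
    show "snd ?l = snd ?m" using l(1) m(1) by (simp add: pointed_at_def)
    have "?m \<in> pointed_at (B \<beta>) i" using m(1) sub by (auto simp: pointed_at_def)
    then have "fst ?m \<subseteq> fst ?l" using l(3)[OF m(1)] n(3) m(2) s by simp
    moreover have "fst ?l \<subseteq> fst ?m" using m(3)[OF l(1)] l(2) n(2) s by simp
    ultimately show "fst ?l = fst ?m" by blast
  qed
  then show ?thesis using \<rho> \<sigma> by (auto simp: Psi_def[of I B \<beta> \<alpha>] Psi_def[of I B \<gamma> \<alpha>])
qed

lemma in_PUC_iff:
  assumes "S \<noteq> {}"
  shows "(S, i) \<in> PUC I C \<longleftrightarrow>
    i \<in> I \<and> (\<forall>x\<in>S. \<exists>Q\<in>pointed_at C i. x \<in> fst Q \<and> fst Q \<subseteq> S)" (is "?l \<longleftrightarrow> ?r")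
proof
  assume ?l
  then show ?r by (auto simp: PUC_def)
next
  assume r: ?r
  let ?D = "{Q \<in> pointed_at C i. fst Q \<subseteq> S}"
  have "S = (\<Union>P\<in>?D. fst P)" using r by blast
  moreover have "?D \<noteq> {}" using r assms by blast
  moreover have "?D \<subseteq> pointed_at C i" by blast
  ultimately show ?l using r unfolding PUC_def by blast
qed

lemma direct_limit_pointed_building_set:
  assumes A: "directed_set A leA"
    and B: "\<And>\<alpha>. \<alpha> \<in> A \<Longrightarrow> pointed_building_set (I \<alpha>) (B \<alpha>)"
    and mono: "\<And>\<alpha> \<beta>. \<lbrakk>\<alpha> \<in> A; \<beta> \<in> A; leA \<alpha> \<beta>\<rbrakk> \<Longrightarrow> B \<alpha> \<subseteq> B \<beta>"
  shows "pointed_building_set (direct_limit_set A I) (direct_limit_pbs A I B)"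
proof -
  let ?I = "direct_limit_set A I" and ?U = "\<Union>\<alpha>\<in>A. B \<alpha>" and ?B = "direct_limit_pbs A I B"
  have ps: "pointed_subset (direct_limit_set A I) P" if "P \<in> ?U" for P
  proof -
    obtain \<alpha> where \<alpha>: "\<alpha> \<in> A" "P \<in> B \<alpha>" using \<open>P \<in> ?U\<close> by blast
    then have "pointed_subset (I \<alpha>) P" using B unfolding pointed_building_set_def by blast
    then show ?thesis using \<alpha> unfolding pointed_subset_def direct_limit_set_def by blast
  qed
  have psB: "i \<in> S \<and> S \<subseteq> ?I \<and> i \<in> ?I" if SB: "(S, i) \<in> ?B" for S i
  proof -
    obtain D where D: "S = (\<Union>P\<in>D. fst P)" "i \<in> ?I" "D \<noteq> {}" "D \<subseteq> pointed_at ?U i"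
      using SB unfolding direct_limit_pbs_def PUC_def by blast
    have "i \<in> fst P \<and> fst P \<subseteq> ?I" if "P \<in> D" for P
    proof -
      have "P \<in> ?U" "snd P = i" using that D(4) unfolding pointed_at_def by blast+
      then show ?thesis using ps unfolding pointed_subset_def by blast
    qed
    then show ?thesis using D(1-3) by blast
  qed
  have mem: "(S, i) \<in> ?B \<longleftrightarrow> i \<in> ?I \<and> (\<forall>x\<in>S. \<exists>Q\<in>pointed_at ?U i. x \<in> fst Q \<and> fst Q \<subseteq> S)"
    if "i \<in> S" for S i
    using that unfolding direct_limit_pbs_def by (intro in_PUC_iff) blast
  have 1: "\<forall>P\<in>?B. pointed_subset ?I P"
    using psB unfolding pointed_subset_def by (metis prod.collapse)
  have 2: "\<forall>i\<in>?I. ({i}, i) \<in> ?B"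
  proof
    fix i assume i: "i \<in> ?I"
    then obtain \<alpha> where "\<alpha> \<in> A" "i \<in> I \<alpha>" unfolding direct_limit_set_def by blast
    then have "({i}, i) \<in> pointed_at (B \<alpha>) i" using pointed_building_setD(2)[OF B] by blast
    then have "({i}, i) \<in> pointed_at ?U i" using \<open>\<alpha> \<in> A\<close> unfolding pointed_at_def by blast
    then show "({i}, i) \<in> ?B" using i by (subst mem) (auto intro: bexI[of _ "({i}, i)"])
  qed
  have 3: "(S \<union> T, i) \<in> ?B" if S: "(S, i) \<in> ?B" and T: "(T, j) \<in> ?B" and j: "j \<in> S" for S i T j
  proof -
    have i: "i \<in> S" "i \<in> ?I" using psB[OF S] by blast+
    have S': "\<exists>Q\<in>pointed_at ?U i. x \<in> fst Q \<and> fst Q \<subseteq> S" if "x \<in> S" for x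
      using S mem[OF i(1)] that by blast
    have T': "\<exists>Q\<in>pointed_at ?U j. x \<in> fst Q \<and> fst Q \<subseteq> T" if "x \<in> T" for x
      using T mem psB[OF T] that by blast
    have "\<exists>Q\<in>pointed_at ?U i. x \<in> fst Q \<and> fst Q \<subseteq> S \<union> T" if "x \<in> S \<union> T" for x
    proof (cases "x \<in> S")
      case True
      then show ?thesis using S' by blast
    next
      case False
      then have "x \<in> T" using that by blast
      then obtain Q where Q: "Q \<in> pointed_at ?U j" "x \<in> fst Q" "fst Q \<subseteq> T" using T' by blast
      obtain P where P: "P \<in> pointed_at ?U i" "j \<in> fst P" "fst P \<subseteq> S" using S'[OF j] by blast
      obtain \<alpha> \<beta> where ab: "\<alpha> \<in> A" "P \<in> B \<alpha>" "\<beta> \<in> A" "Q \<in> B \<beta>"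
        using P Q unfolding pointed_at_def by blast
      then obtain \<gamma> where c: "\<gamma> \<in> A" "leA \<alpha> \<gamma>" "leA \<beta> \<gamma>"
        using A unfolding directed_set_def by blast
      have "P \<in> B \<gamma>" "Q \<in> B \<gamma>" using mono[of \<alpha> \<gamma>] mono[of \<beta> \<gamma>] ab c by blast+
      then have "(fst P, i) \<in> B \<gamma>" "(fst Q, j) \<in> B \<gamma>"
        using pointed_at_pair[of P "B \<gamma>" i] pointed_at_pair[of Q "B \<gamma>" j] P(1) Q(1)
        unfolding pointed_at_def by blast+
      then have "(fst P \<union> fst Q, i) \<in> B \<gamma>"
        using pointed_building_setD(3)[OF B[OF c(1)]] P(2) by blast
      then have "(fst P \<union> fst Q, i) \<in> pointed_at ?U i"
        using c(1) unfolding pointed_at_def by auto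
      then show ?thesis using P Q by (intro bexI[of _ "(fst P \<union> fst Q, i)"]) auto
    qed
    then show ?thesis using mem[of i "S \<union> T"] i by blast
  qed
  have 4: "(\<Union>P\<in>C. fst P, i) \<in> ?B" if i: "i \<in> ?I" and C: "C \<noteq> {}" "C \<subseteq> pointed_at ?B i" for i C
  proof -
    have C': "(fst P, i) \<in> ?B" if "P \<in> C" for P
      using that C(2) by (blast intro: pointed_at_pair)
    have "i \<in> (\<Union>P\<in>C. fst P)" using C(1) C' psB by blast
    moreover have "\<exists>Q\<in>pointed_at ?U i. x \<in> fst Q \<and> fst Q \<subseteq> (\<Union>P\<in>C. fst P)"
      if x: "x \<in> (\<Union>P\<in>C. fst P)" for x
    proof -
      obtain P where P: "P \<in> C" "x \<in> fst P" using x by blast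
      then have "\<exists>Q\<in>pointed_at ?U i. x \<in> fst Q \<and> fst Q \<subseteq> fst P"
        using mem C' psB by blast
      then show ?thesis using P by blast
    qed
    ultimately show ?thesis by (subst mem) (use i in blast)+
  qed
  show ?thesis
    unfolding pointed_building_set_def
    using 1 2 3 4 by (intro conjI allI impI ballI) simp_all
qed

end

theory Submission
  imports Defs
begin

text \<open>
  Write \<open>I\<^sub>\<infinity>\<close> and \<open>B\<^sub>\<infinity>\<close> for the direct limits.  The pair \<open>(I\<^sub>\<infinity>, B\<^sub>\<infinity>)\<close> is itself a pointed building
  set that contains every \<open>(I \<alpha>, B \<alpha>)\<close>, so it extends the system by one index \<open>None\<close> above all the
  others.  The transition maps out of that index form a cone from the ornamentations of \<open>B\<^sub>\<infinity>\<close> over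
  the inverse system, because transition maps compose; the universal property turns the cone into
  an order-preserving map to the inverse limit.

  The inverse map glues a compatible family \<open>x\<close>: it sends \<open>i\<close> to the union of the sets \<open>x \<alpha> i\<close> over
  all \<open>\<alpha>\<close> with \<open>i \<in> I \<alpha>\<close>.  Compatibility makes these sets increase with \<open>\<alpha>\<close>
  (\<open>compatible_increasing\<close>), so that the union is directed and nestedness of the glued function can
  be checked at a single stage (\<open>glue_ornamentation\<close>).

  Gluing the restrictions of an ornamentation \<open>\<rho>\<close> of \<open>B\<^sub>\<infinity>\<close> returns \<open>\<rho>\<close>, since each set of \<open>B\<^sub>\<infinity>\<close> is a
  union of sets that lie in some \<open>B \<alpha>\<close> (\<open>glue_restrictions\<close>).  Restricting a glued family to stage
  \<open>\<alpha>\<close> returns \<open>x \<alpha>\<close> by local finiteness: a set of \<open>B \<alpha>\<close> inside the directed union is finite,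
  hence already inside \<open>x \<gamma> i\<close> for some \<open>\<gamma> \<ge> \<alpha>\<close>, and so inside \<open>x \<alpha> i\<close> by compatibility (\<open>restrict_glue\<close>).
\<close>

section \<open>Directed sets and ornamentations\<close>

lemma directed_set_upper_bound:
  assumes "directed_set A leA" "\<alpha> \<in> A" "\<beta> \<in> A"
  obtains \<gamma> where "\<gamma> \<in> A" "leA \<alpha> \<gamma>" "leA \<beta> \<gamma>"
  using assms unfolding directed_set_def by blast

lemma finite_subset_directed_UN:
  assumes A: "directed_set A leA"
    and mono: "\<And>\<alpha> \<beta>. \<lbrakk>\<alpha> \<in> A; \<beta> \<in> A; leA \<alpha> \<beta>\<rbrakk> \<Longrightarrow> F \<alpha> \<subseteq> F \<beta>"
    and Q: "finite Q" "Q \<subseteq> (\<Union>\<alpha>\<in>A. F \<alpha>)"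
  shows "\<exists>\<gamma>\<in>A. Q \<subseteq> F \<gamma>"
  using Q
proof (induction Q rule: finite_induct)
  case empty
  then show ?case using A unfolding directed_set_def by blast
next
  case (insert q Q)
  then obtain \<alpha> \<beta> where "\<alpha> \<in> A" "Q \<subseteq> F \<alpha>" "\<beta> \<in> A" "q \<in> F \<beta>" by auto
  moreover from this obtain \<gamma> where "\<gamma> \<in> A" "leA \<alpha> \<gamma>" "leA \<beta> \<gamma>"
    using directed_set_upper_bound[OF A] by metis
  ultimately show ?case using mono[of \<alpha> \<gamma>] mono[of \<beta> \<gamma>] by blast
qed

lemma pointed_at_eqI:
  assumes "P \<in> pointed_at C i" "Q \<in> pointed_at C' i" "fst P = fst Q"
  shows "P = Q"
  using assms by (auto simp: pointed_at_def intro: prod_eqI)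

lemma ornamentation_eqI:
  assumes "\<rho> \<in> ornamentations I B" "\<sigma> \<in> ornamentations I B"
    and "\<And>i. i \<in> I \<Longrightarrow> fst (\<rho> i) = fst (\<sigma> i)"
  shows "\<rho> = \<sigma>"
proof (rule PiE_ext)
  show "\<rho> \<in> (\<Pi>\<^sub>E i\<in>I. pointed_at B i)" "\<sigma> \<in> (\<Pi>\<^sub>E i\<in>I. pointed_at B i)"
    using assms(1,2) by (simp_all add: ornamentations_def)
  then show "\<rho> i = \<sigma> i" if "i \<in> I" for i
    using that assms(3) by (blast intro: pointed_at_eqI)
qed


section \<open>The direct limit as a top stage of the system\<close>

locale pbs_system =
  fixes A :: "'k set" and leA :: "'k \<Rightarrow> 'k \<Rightarrow> bool"
    and I :: "'k \<Rightarrow> 'a set" and B :: "'k \<Rightarrow> ('a set \<times> 'a) set"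
  assumes directed: "directed_set A leA"
    and pbs: "\<And>\<alpha>. \<alpha> \<in> A \<Longrightarrow> pointed_building_set (I \<alpha>) (B \<alpha>)"
    and I_mono: "\<And>\<alpha> \<beta>. \<lbrakk>\<alpha> \<in> A; \<beta> \<in> A; leA \<alpha> \<beta>\<rbrakk> \<Longrightarrow> I \<alpha> \<subseteq> I \<beta>"
    and B_mono: "\<And>\<alpha> \<beta>. \<lbrakk>\<alpha> \<in> A; \<beta> \<in> A; leA \<alpha> \<beta>\<rbrakk> \<Longrightarrow> B \<alpha> \<subseteq> B \<beta>"
begin

abbreviation I_lim ("I\<^sub>\<infinity>") where "I\<^sub>\<infinity> \<equiv> direct_limit_set A I"

abbreviation B_lim ("B\<^sub>\<infinity>") where "B\<^sub>\<infinity> \<equiv> direct_limit_pbs A I B"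

abbreviation orn_system where "orn_system \<equiv> \<lambda>\<alpha>. ornamentation_poset (I \<alpha>) (B \<alpha>)"

abbreviation orn_limit where "orn_limit \<equiv> inverse_limit A leA orn_system (Psi I B)"

abbreviation orn_top where "orn_top \<equiv> ornamentation_poset I\<^sub>\<infinity> B\<^sub>\<infinity>"

text \<open>Adjoining the direct limit at the new index \<open>None\<close> makes restriction to stage \<open>\<alpha>\<close> a transition
  map like any other, so that the general facts on \<open>Psi\<close> apply to it.\<close>

abbreviation restriction where
  "restriction \<alpha> \<equiv> Psi (case_option I\<^sub>\<infinity> I) (case_option B\<^sub>\<infinity> B) None (Some \<alpha>)"

lemma pbs_limit: "pointed_building_set I\<^sub>\<infinity> B\<^sub>\<infinity>"
  by (rule direct_limit_pointed_building_set[OF directed pbs B_mono])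

lemma I_subset_limit: "\<alpha> \<in> A \<Longrightarrow> I \<alpha> \<subseteq> I\<^sub>\<infinity>"
  unfolding direct_limit_set_def by blast

lemma in_B_limitI:
  assumes "i \<in> I\<^sub>\<infinity>" "D \<noteq> {}" "\<And>P. P \<in> D \<Longrightarrow> \<exists>\<alpha>\<in>A. P \<in> pointed_at (B \<alpha>) i"
  shows "(\<Union>P\<in>D. fst P, i) \<in> pointed_at B\<^sub>\<infinity> i"
proof -
  have "D \<subseteq> pointed_at (\<Union>\<alpha>\<in>A. B \<alpha>) i"
    using assms(3) unfolding pointed_at_def by blast
  then have "(\<Union>P\<in>D. fst P, i) \<in> B\<^sub>\<infinity>"
    using assms(1,2) unfolding direct_limit_pbs_def PUC_def by blast
  then show ?thesis by (simp add: pointed_at_def)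
qed

lemma in_B_limitE:
  assumes "P \<in> pointed_at B\<^sub>\<infinity> i" "x \<in> fst P"
  obtains \<alpha> Q where "\<alpha> \<in> A" "Q \<in> pointed_at (B \<alpha>) i" "x \<in> fst Q" "fst Q \<subseteq> fst P"
proof -
  have "(fst P, i) \<in> B\<^sub>\<infinity>" using assms(1) by (rule pointed_at_pair)
  then obtain D where "fst P = (\<Union>Q\<in>D. fst Q)" "D \<subseteq> pointed_at (\<Union>\<alpha>\<in>A. B \<alpha>) i"
    unfolding direct_limit_pbs_def PUC_def by auto
  then obtain Q where "Q \<in> pointed_at (\<Union>\<alpha>\<in>A. B \<alpha>) i" "x \<in> fst Q" "fst Q \<subseteq> fst P"
    using assms(2) by blast
  then show ?thesis using that unfolding pointed_at_def by blast
qed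

lemma B_subset_limit:
  assumes \<alpha>: "\<alpha> \<in> A" shows "B \<alpha> \<subseteq> B\<^sub>\<infinity>"
proof
  fix P assume P: "P \<in> B \<alpha>"
  then have at: "P \<in> pointed_at (B \<alpha>) (snd P)" by (simp add: pointed_at_def)
  then have "snd P \<in> I\<^sub>\<infinity>"
    using pointed_building_setD(1)[OF pbs[OF \<alpha>]] I_subset_limit[OF \<alpha>] by blast
  from in_B_limitI[OF this, of "{P}"] show "P \<in> B\<^sub>\<infinity>"
    using \<alpha> at by (auto simp: pointed_at_def)
qed

lemma restriction_poset_hom: "\<alpha> \<in> A \<Longrightarrow> restriction \<alpha> \<in> poset_hom orn_top (orn_system \<alpha>)"
  using Psi_poset_hom[of "case_option I\<^sub>\<infinity> I" "Some \<alpha>" "case_option B\<^sub>\<infinity> B" None]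
    pbs pbs_limit I_subset_limit by simp

lemma restriction_compatible:
  assumes "\<alpha> \<in> A" "\<beta> \<in> A" "leA \<alpha> \<beta>" "\<rho> \<in> carrier orn_top"
  shows "Psi I B \<beta> \<alpha> (restriction \<beta> \<rho>) = restriction \<alpha> \<rho>"
proof -
  have "Psi (case_option I\<^sub>\<infinity> I) (case_option B\<^sub>\<infinity> B) (Some \<beta>) (Some \<alpha>) (restriction \<beta> \<rho>)
      = restriction \<alpha> \<rho>"
    by (rule Psi_comp)
      (use assms in \<open>simp_all add: pbs pbs_limit I_mono B_mono I_subset_limit ornamentation_poset_def\<close>)
  then show ?thesis by (simp add: Psi_def)
qed

lemma restriction_ornamentation:
  "\<lbrakk>\<alpha> \<in> A; \<rho> \<in> ornamentations I\<^sub>\<infinity> B\<^sub>\<infinity>\<rbrakk> \<Longrightarrow> restriction \<alpha> \<rho> \<in> ornamentations (I \<alpha>) (B \<alpha>)"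
  using restriction_poset_hom by (auto simp: poset_hom_def ornamentation_poset_def)

lemma restriction_subset:
  assumes "\<alpha> \<in> A" "\<rho> \<in> ornamentations I\<^sub>\<infinity> B\<^sub>\<infinity>" "i \<in> I \<alpha>"
  shows "fst (restriction \<alpha> \<rho> i) \<subseteq> fst (\<rho> i)"
    and "\<lbrakk>Q \<in> pointed_at (B \<alpha>) i; fst Q \<subseteq> fst (\<rho> i)\<rbrakk> \<Longrightarrow> fst Q \<subseteq> fst (restriction \<alpha> \<rho> i)"
proof -
  have "i \<in> fst (\<rho> i)"
    using ornamentationsD(2)[OF pbs_limit assms(2)] I_subset_limit assms(1,3) by blast
  note largest_inside[OF pbs[OF assms(1)] assms(3) this]
  then show "fst (restriction \<alpha> \<rho> i) \<subseteq> fst (\<rho> i)"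
    and "\<lbrakk>Q \<in> pointed_at (B \<alpha>) i; fst Q \<subseteq> fst (\<rho> i)\<rbrakk> \<Longrightarrow> fst Q \<subseteq> fst (restriction \<alpha> \<rho> i)"
    using assms by (simp_all add: Psi_def)
qed


section \<open>Compatible families\<close>

text \<open>Values are taken only at stages that contain the point: elsewhere the members of a family are
  \<open>undefined\<close>.\<close>

abbreviation stages where "stages i \<equiv> {\<alpha> \<in> A. i \<in> I \<alpha>}"

lemma directed_stages:
  assumes "i \<in> I\<^sub>\<infinity>" shows "directed_set (stages i) leA"
proof -
  have "\<exists>\<gamma>\<in>stages i. leA \<alpha> \<gamma> \<and> leA \<beta> \<gamma>" if s: "\<alpha> \<in> stages i" "\<beta> \<in> stages i" for \<alpha> \<beta>
  proof -
    obtain \<gamma> where "\<gamma> \<in> A" "leA \<alpha> \<gamma>" "leA \<beta> \<gamma>"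
      using directed_set_upper_bound[OF directed, of \<alpha> \<beta>] s by blast
    then show ?thesis using I_mono[of \<alpha> \<gamma>] s by blast
  qed
  moreover have "stages i \<noteq> {}" using assms unfolding direct_limit_set_def by blast
  moreover have "reflp_on (stages i) leA" "transp_on (stages i) leA"
    using directed unfolding directed_set_def
    by (auto intro: reflp_on_subset transp_on_subset)
  ultimately show ?thesis unfolding directed_set_def by blast
qed

lemma compatibleD:
  assumes "x \<in> carrier orn_limit"
  shows "\<And>\<alpha>. \<alpha> \<in> A \<Longrightarrow> x \<alpha> \<in> ornamentations (I \<alpha>) (B \<alpha>)"
    and "\<And>\<alpha> \<beta>. \<lbrakk>\<alpha> \<in> A; \<beta> \<in> A; leA \<alpha> \<beta>\<rbrakk> \<Longrightarrow> Psi I B \<beta> \<alpha> (x \<beta>) = x \<alpha>"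
  using assms by (auto simp: inverse_limit_def ornamentation_poset_def)

lemma compatible_largest:
  assumes x: "x \<in> carrier orn_limit" and \<alpha>\<beta>: "\<alpha> \<in> A" "\<beta> \<in> A" "leA \<alpha> \<beta>" and i: "i \<in> I \<alpha>"
  shows compatible_increasing: "fst (x \<alpha> i) \<subseteq> fst (x \<beta> i)"
    and "\<lbrakk>Q \<in> pointed_at (B \<alpha>) i; fst Q \<subseteq> fst (x \<beta> i)\<rbrakk> \<Longrightarrow> fst Q \<subseteq> fst (x \<alpha> i)"
proof -
  have "i \<in> I \<beta>" using I_mono[OF \<alpha>\<beta>] i by blast
  then have "i \<in> fst (x \<beta> i)"
    by (rule ornamentationsD(2)[OF pbs[OF \<alpha>\<beta>(2)] compatibleD(1)[OF x \<alpha>\<beta>(2)]])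
  note l = largest_inside[OF pbs[OF \<alpha>\<beta>(1)] i this]
  have "largest_inside (B \<alpha>) i (fst (x \<beta> i)) = Psi I B \<beta> \<alpha> (x \<beta>) i"
    using compatibleD(1)[OF x \<alpha>\<beta>(2)] i by (simp add: Psi_def)
  also have "\<dots> = x \<alpha> i" using compatibleD(2)[OF x \<alpha>\<beta>] by simp
  finally have e: "largest_inside (B \<alpha>) i (fst (x \<beta> i)) = x \<alpha> i" .
  show "fst (x \<alpha> i) \<subseteq> fst (x \<beta> i)"
    and "\<lbrakk>Q \<in> pointed_at (B \<alpha>) i; fst Q \<subseteq> fst (x \<beta> i)\<rbrakk> \<Longrightarrow> fst Q \<subseteq> fst (x \<alpha> i)"
    using l(2,3)[unfolded e] by blast+
qed

definition glue :: "('k \<Rightarrow> 'a \<Rightarrow> 'a set \<times> 'a) \<Rightarrow> 'a \<Rightarrow> 'a set \<times> 'a" where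
  "glue x = (\<lambda>i\<in>I\<^sub>\<infinity>. (\<Union>\<alpha>\<in>stages i. fst (x \<alpha> i), i))"

lemma fst_glue: "i \<in> I\<^sub>\<infinity> \<Longrightarrow> fst (glue x i) = (\<Union>\<alpha>\<in>stages i. fst (x \<alpha> i))"
  by (simp add: glue_def)

text \<open>Nestedness needs directedness: a point \<open>j\<close> of the value at \<open>i\<close> may appear at one stage and a
  piece of the value at \<open>j\<close> at another, and only at a common later stage is the nestedness of a
  single ornamentation available.\<close>

lemma glue_ornamentation:
  assumes x: "x \<in> carrier orn_limit"
  shows "glue x \<in> ornamentations I\<^sub>\<infinity> B\<^sub>\<infinity>"
proof -
  note orn = ornamentationsD[OF pbs compatibleD(1)[OF x]]
  have "glue x i \<in> pointed_at B\<^sub>\<infinity> i" if i: "i \<in> I\<^sub>\<infinity>" for i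
  proof -
    have "(\<Union>P\<in>(\<lambda>\<alpha>. x \<alpha> i) ` stages i. fst P, i) \<in> pointed_at B\<^sub>\<infinity> i"
    proof (rule in_B_limitI[OF i])
      show "(\<lambda>\<alpha>. x \<alpha> i) ` stages i \<noteq> {}"
        using directed_stages[OF i] unfolding directed_set_def by blast
    qed (use orn(1) in blast)
    then show ?thesis using i by (simp add: glue_def)
  qed
  moreover have "fst (glue x j) \<subseteq> fst (glue x i)" if i: "i \<in> I\<^sub>\<infinity>" and j_in: "j \<in> fst (glue x i)" for i j
  proof -
    obtain \<alpha> where \<alpha>: "\<alpha> \<in> A" "i \<in> I \<alpha>" "j \<in> fst (x \<alpha> i)"
      using j_in fst_glue[OF i] by auto
    then have j: "j \<in> I \<alpha>" using orn(3) by blast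
    then have "j \<in> I\<^sub>\<infinity>" using I_subset_limit \<alpha>(1) by blast
    moreover have "fst (x \<beta> j) \<subseteq> fst (glue x i)" if \<beta>: "\<beta> \<in> A" "j \<in> I \<beta>" for \<beta>
    proof -
      obtain \<gamma> where \<gamma>: "\<gamma> \<in> A" "leA \<alpha> \<gamma>" "leA \<beta> \<gamma>"
        using directed_set_upper_bound[OF directed \<alpha>(1) \<beta>(1)] .
      then have i\<gamma>: "i \<in> I \<gamma>" using I_mono[of \<alpha> \<gamma>] \<alpha> by blast
      have "fst (x \<beta> j) \<subseteq> fst (x \<gamma> j)" using compatible_increasing[OF x \<beta>(1) \<gamma>(1,3) \<beta>(2)] .
      also have "\<dots> \<subseteq> fst (x \<gamma> i)"
        using orn(4)[OF \<gamma>(1) \<gamma>(1) i\<gamma>] compatible_increasing[OF x \<alpha>(1) \<gamma>(1,2) \<alpha>(2)] \<alpha>(3) by blast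
      also have "\<dots> \<subseteq> fst (glue x i)" using fst_glue[OF i] \<gamma>(1) i\<gamma> by blast
      finally show ?thesis .
    qed
    ultimately show ?thesis by (auto simp: fst_glue)
  qed
  ultimately show ?thesis
    unfolding ornamentations_def by (auto simp: glue_def)
qed

lemma glue_poset_hom: "restrict glue (carrier orn_limit) \<in> poset_hom orn_limit orn_top"
proof -
  have "fst (glue x i) \<subseteq> fst (glue y i)"
    if "\<And>\<alpha> i. \<lbrakk>\<alpha> \<in> A; i \<in> I \<alpha>\<rbrakk> \<Longrightarrow> fst (x \<alpha> i) \<subseteq> fst (y \<alpha> i)" "i \<in> I\<^sub>\<infinity>" for x y i
    using that by (fastforce simp: fst_glue)
  moreover have "partial_order orn_limit" "partial_order orn_top"
    by (rule partial_order_inverse_limit partial_order_ornamentation_poset)+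
  ultimately show ?thesis
    using glue_ornamentation unfolding poset_hom_def isotone_def
    by (auto simp: ornamentation_poset_def inverse_limit_def dest: partial_order.axioms(1))
qed


section \<open>Restriction and gluing are mutually inverse\<close>

text \<open>A point of the value at \<open>i\<close> lies in a subset that belongs to some \<open>B \<alpha>\<close>, and the restriction
  to stage \<open>\<alpha>\<close>, being largest, contains that subset.\<close>

lemma glue_restrictions:
  assumes \<rho>: "\<rho> \<in> ornamentations I\<^sub>\<infinity> B\<^sub>\<infinity>" and i: "i \<in> I\<^sub>\<infinity>"
  shows "(\<Union>\<alpha>\<in>stages i. fst (restriction \<alpha> \<rho> i)) = fst (\<rho> i)"
proof
  show "(\<Union>\<alpha>\<in>stages i. fst (restriction \<alpha> \<rho> i)) \<subseteq> fst (\<rho> i)"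
    using restriction_subset(1)[OF _ \<rho>] by blast
next
  show "fst (\<rho> i) \<subseteq> (\<Union>\<alpha>\<in>stages i. fst (restriction \<alpha> \<rho> i))"
  proof
    fix p assume "p \<in> fst (\<rho> i)"
    then obtain \<alpha> Q
      where Q: "\<alpha> \<in> A" "Q \<in> pointed_at (B \<alpha>) i" "p \<in> fst Q" "fst Q \<subseteq> fst (\<rho> i)"
      using in_B_limitE[OF ornamentationsD(1)[OF pbs_limit \<rho> i]] by blast
    then have "i \<in> I \<alpha>" using pointed_building_setD(1)[OF pbs] by blast
    then show "p \<in> (\<Union>\<alpha>\<in>stages i. fst (restriction \<alpha> \<rho> i))"
      using restriction_subset(2)[OF Q(1) \<rho>] Q by blast
  qed
qed

text \<open>A finite subset of a directed union lies in one of its members, and compatibility brings it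
  back from that stage to \<open>\<alpha>\<close>.  Without finiteness, a set of \<open>B \<alpha>\<close> could lie inside the glued set and yet inside no single
  \<open>x \<gamma> i\<close>.\<close>

lemma restrict_glue:
  assumes x: "x \<in> carrier orn_limit" and \<alpha>: "\<alpha> \<in> A" and fin: "locally_finite (I \<alpha>) (B \<alpha>)"
  shows "restriction \<alpha> (glue x) = x \<alpha>"
proof (rule ornamentation_eqI)
  note g = glue_ornamentation[OF x]
  show r: "restriction \<alpha> (glue x) \<in> ornamentations (I \<alpha>) (B \<alpha>)"
    using restriction_ornamentation[OF \<alpha> g] .
  show x\<alpha>: "x \<alpha> \<in> ornamentations (I \<alpha>) (B \<alpha>)" using compatibleD(1)[OF x \<alpha>] .
  fix i assume i: "i \<in> I \<alpha>"
  then have i': "i \<in> I\<^sub>\<infinity>" using I_subset_limit[OF \<alpha>] by blast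
  let ?Q = "restriction \<alpha> (glue x) i"
  have Q: "?Q \<in> pointed_at (B \<alpha>) i" using ornamentationsD(1)[OF pbs[OF \<alpha>] r i] .
  have "\<exists>\<beta>\<in>stages i. fst ?Q \<subseteq> fst (x \<beta> i)"
  proof (rule finite_subset_directed_UN[OF directed_stages[OF i']])
    show "finite (fst ?Q)" using fin i Q unfolding locally_finite_def by blast
    show "fst ?Q \<subseteq> (\<Union>\<beta>\<in>stages i. fst (x \<beta> i))"
      using restriction_subset(1)[OF \<alpha> g i] fst_glue[OF i'] by simp
  qed (use compatible_increasing[OF x] in blast)
  then obtain \<beta> where \<beta>: "\<beta> \<in> A" "i \<in> I \<beta>" "fst ?Q \<subseteq> fst (x \<beta> i)" by blast
  obtain \<gamma> where \<gamma>: "\<gamma> \<in> A" "leA \<alpha> \<gamma>" "leA \<beta> \<gamma>"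
    using directed_set_upper_bound[OF directed \<alpha> \<beta>(1)] .
  have "fst ?Q \<subseteq> fst (x \<gamma> i)"
    using \<beta>(3) compatible_increasing[OF x \<beta>(1) \<gamma>(1,3) \<beta>(2)] by blast
  then have "fst ?Q \<subseteq> fst (x \<alpha> i)" by (rule compatible_largest(2)[OF x \<alpha> \<gamma>(1,2) i Q])
  moreover have "fst (x \<alpha> i) \<subseteq> fst ?Q"
  proof (rule restriction_subset(2)[OF \<alpha> g i])
    show "x \<alpha> i \<in> pointed_at (B \<alpha>) i" using ornamentationsD(1)[OF pbs[OF \<alpha>] x\<alpha> i] .
    show "fst (x \<alpha> i) \<subseteq> fst (glue x i)" using fst_glue[OF i'] \<alpha> i by blast
  qed
  ultimately show "fst ?Q = fst (x \<alpha> i)" by blast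
qed

theorem limit_isomorphism:
  assumes fin: "\<And>\<alpha>. \<alpha> \<in> A \<Longrightarrow> locally_finite (I \<alpha>) (B \<alpha>)"
  shows "poset_isomorphic orn_limit orn_top"
proof -
  have po: "partial_order orn_limit" "partial_order orn_top"
    by (rule partial_order_inverse_limit partial_order_ornamentation_poset)+
  obtain h where h: "h \<in> poset_hom orn_top orn_limit"
    and h_eq: "\<And>\<alpha> \<rho>. \<lbrakk>\<alpha> \<in> A; \<rho> \<in> carrier orn_top\<rbrakk> \<Longrightarrow> h \<rho> \<alpha> = restriction \<alpha> \<rho>"
    using inverse_limit_universal[where A = A and leA = leA and P = orn_system and \<phi> = "Psi I B"
        and f = restriction, OF partial_order_ornamentation_poset po(2)
        restriction_poset_hom restriction_compatible]
    by blast
  have h_carrier: "h \<rho> \<in> carrier orn_limit" if "\<rho> \<in> carrier orn_top" for \<rho>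
    using h that by (auto simp: poset_hom_def)
  have glue_carrier: "glue x \<in> carrier orn_top" if "x \<in> carrier orn_limit" for x
    using glue_ornamentation[OF that] by (simp add: ornamentation_poset_def)
  have "h (glue x) = x" if x: "x \<in> carrier orn_limit" for x
  proof (rule PiE_ext)
    show "h (glue x) \<in> (\<Pi>\<^sub>E \<alpha>\<in>A. carrier (orn_system \<alpha>))" "x \<in> (\<Pi>\<^sub>E \<alpha>\<in>A. carrier (orn_system \<alpha>))"
      using h_carrier[OF glue_carrier[OF x]] x by (simp_all add: inverse_limit_def)
    show "h (glue x) \<alpha> = x \<alpha>" if "\<alpha> \<in> A" for \<alpha>
      using h_eq[OF that glue_carrier[OF x]] restrict_glue[OF x that fin[OF that]] by simp
  qed
  moreover have "glue (h \<rho>) = \<rho>" if \<rho>: "\<rho> \<in> carrier orn_top" for \<rho>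
  proof (rule ornamentation_eqI)
    show \<rho>': "\<rho> \<in> ornamentations I\<^sub>\<infinity> B\<^sub>\<infinity>" using \<rho> by (simp add: ornamentation_poset_def)
    show "glue (h \<rho>) \<in> ornamentations I\<^sub>\<infinity> B\<^sub>\<infinity>" using glue_ornamentation[OF h_carrier[OF \<rho>]] .
    show "fst (glue (h \<rho>) i) = fst (\<rho> i)" if "i \<in> I\<^sub>\<infinity>" for i
      using glue_restrictions[OF \<rho>' that] h_eq[OF _ \<rho>] by (simp add: fst_glue[OF that])
  qed
  ultimately show ?thesis
    unfolding poset_isomorphic_def using po h glue_poset_hom h_carrier
    by (intro conjI bexI[of _ h] bexI[of _ "restrict glue (carrier orn_limit)"]) auto
qed

end

theorem theorem6p7:
  fixes A :: "'k set" and leA :: "'k \<Rightarrow> 'k \<Rightarrow> bool"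
    and I :: "'k \<Rightarrow> 'a set" and B :: "'k \<Rightarrow> ('a set \<times> 'a) set"
  assumes "directed_set A leA"
    and "\<And>\<alpha>. \<alpha> \<in> A \<Longrightarrow> pointed_building_set (I \<alpha>) (B \<alpha>)"
    and "\<And>\<alpha> \<beta>. \<lbrakk>\<alpha> \<in> A; \<beta> \<in> A; leA \<alpha> \<beta>\<rbrakk> \<Longrightarrow> I \<alpha> \<subseteq> I \<beta>"
    and "\<And>\<alpha> \<beta>. \<lbrakk>\<alpha> \<in> A; \<beta> \<in> A; leA \<alpha> \<beta>\<rbrakk> \<Longrightarrow> B \<alpha> \<subseteq> B \<beta>"
    and "\<And>\<alpha>. \<alpha> \<in> A \<Longrightarrow> locally_finite (I \<alpha>) (B \<alpha>)"
  shows "poset_isomorphic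
    (inverse_limit A leA (\<lambda>\<alpha>. ornamentation_poset (I \<alpha>) (B \<alpha>)) (Psi I B))
    (ornamentation_poset (direct_limit_set A I) (direct_limit_pbs A I B))"
proof -
  interpret pbs_system A leA I B
    by unfold_locales (rule assms(1-4); assumption?)+
  show ?thesis using assms(5) by (rule limit_isomorphism)
qed

end
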